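(* Let $b\in\mathbb N$, $k,\ell,d,t\in\mathbb N_+$ with $b+\ell\ge3$ and $d+1<t\le k-1$; set $n=b(k+1)+\ell k+d$ and $a=b+(b+\ell)(k-t)+t-1$, and consider $g=((k+1)^{[b]},k^{[\ell]},1^{[d]})$ and $m=(a,t^{[b+\ell-1]},d+1)$. Then $g\in\mathcal J(\mathcal L_n)$ is of type D with $k\ge4$, $m\in\mathcal M(\mathcal L_n)$ is of type IV with $a\ge t+2$, and $g\swarrow m$ holds but $g\nearrow m$ does not hold.
   Context: $\mathbb N=\{0,1,2,\dots\}$, $\mathbb N_+=\mathbb N\setminus\{0\}$. A partition of $n\in\mathbb N$ is a tuple $(a_1,\dots,a_n)$ of natural numbers with $a_1\ge\dots\ge a_n\ge 0$ and $\sum a_i=n$; trailing zeros may be omitted or added. $x^{[s]}$ denotes $s$ consecutive entries equal to $x$ (no entry if $s=0$). $\mathcal L_n$ is the finite lattice of all partitions of $n$ under the dominance order: $a\le b$ iff $\sum_{i=1}^j a_i\le\sum_{i=1}^j b_i$ for all $1\le j\le n$. $\mathcal J(\mathcal L_n)$ is the set of (completely) join-irreducible elements (not the least element, and $x=y\vee z$ implies $x=y$ or $x=z$); $\mathcal M(\mathcal L_n)$ is the set of (completely) meet-irreducible elements (not the greatest element, and $x=y\wedge z$ implies $x=y$ or $x=z$). Arrow relations of the standard context $(\mathcal J(\mathcal L_n),\mathcal M(\mathcal L_n),\le)$: for $g\in\mathcal J(\mathcal L_n)$ and $m\in\mathcal M(\mathcal L_n)$ put $g'=\{y\in\mathcal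 M(\mathcal L_n): g\le y\}$ and $m'=\{y\in\mathcal J(\mathcal L_n): y\le m\}$. Then $g\swarrow m$ iff $g\nleq m$ and for all $h\in\mathcal J(\mathcal L_n)$ with $g'\subsetneq h'$ we have $h\le m$; and $g\nearrow m$ iff $g\nleq m$ and for all $y\in\mathcal M(\mathcal L_n)$ with $m'\subsetneq y'$ we have $g\le y$. Types of partitions of $n$: type D (in $\mathcal J(\mathcal L_n)$): $((k+1)^{[b]},k^{[\ell]},1^{[d]})$ with $b\in\mathbb N$, $\ell,d\in\mathbb N_+$, $k\ge3$, $b+\ell\ge2$; type IV (in $\mathcal M(\mathcal L_n)$): $(a,t^{[c]},r)$ with $a>t>r\ge0$ and $t,c\ge2$. *)

theory Defs
  imports "HOL-Algebra.Lattice"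
begin

text \<open>A partition of \<open>n\<close> is a tuple of length exactly \<open>n\<close>, padded with zeros; the entry \<open>a\<^sub>i\<close> of
  the tuple is \<open>a ! (i - 1)\<close>, and \<open>a\<^sub>1 + \<dots> + a\<^sub>j\<close> is \<^term>\<open>sum_list (take j a)\<close>.\<close>

definition partitions :: "nat \<Rightarrow> nat list set" where
  "partitions n = {a. length a = n \<and> sorted_wrt (\<ge>) a \<and> sum_list a = n}"

definition pad :: "nat \<Rightarrow> nat list \<Rightarrow> nat list" where
  "pad n xs = xs @ replicate (n - length xs) 0"

definition partition_lattice :: "nat \<Rightarrow> nat list gorder" where
  "partition_lattice n =
     \<lparr>carrier = partitions n, eq = (=),
      le = (\<lambda>a b. \<forall>j\<in>{1..n}. sum_list (take j a) \<le> sum_list (take j b))\<rparr>"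

text \<open>The following notions are meant for finite nonempty lattices, where irreducible and completely
  irreducible elements coincide and where \<open>\<squnion>\<close>, \<open>\<sqinter>\<close>, \<open>\<bottom>\<close>, \<open>\<top>\<close> (choice operators in the
  library) are the actual join, meet, least and greatest element.\<close>

definition join_irreducibles :: "('a, 'b) gorder_scheme \<Rightarrow> 'a set" where
  "join_irreducibles L =
     {x \<in> carrier L. x \<noteq> \<bottom>\<^bsub>L\<^esub> \<and>
        (\<forall>y\<in>carrier L. \<forall>z\<in>carrier L. x = y \<squnion>\<^bsub>L\<^esub> z \<longrightarrow> x = y \<or> x = z)}"

definition meet_irreducibles :: "('a, 'b) gorder_scheme \<Rightarrow> 'a set" where
  "meet_irreducibles L =
     {x \<in> carrier L. x \<noteq> \<top>\<^bsub>L\<^esub> \<and>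
        (\<forall>y\<in>carrier L. \<forall>z\<in>carrier L. x = y \<sqinter>\<^bsub>L\<^esub> z \<longrightarrow> x = y \<or> x = z)}"

text \<open>The derivations \<open>g'\<close> and \<open>m'\<close> in the standard context of \<open>L\<close>.\<close>

definition object_intent :: "('a, 'b) gorder_scheme \<Rightarrow> 'a \<Rightarrow> 'a set" where
  "object_intent L g = {y \<in> meet_irreducibles L. g \<sqsubseteq>\<^bsub>L\<^esub> y}"

definition attribute_extent :: "('a, 'b) gorder_scheme \<Rightarrow> 'a \<Rightarrow> 'a set" where
  "attribute_extent L m = {y \<in> join_irreducibles L. y \<sqsubseteq>\<^bsub>L\<^esub> m}"

text \<open>The arrow relations \<open>g \<swarrow> m\<close> and \<open>g \<nearrow> m\<close>, to be used only for
  \<open>g\<close> join-irreducible and \<open>m\<close> meet-irreducible.\<close>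

definition down_arrow :: "('a, 'b) gorder_scheme \<Rightarrow> 'a \<Rightarrow> 'a \<Rightarrow> bool" where
  "down_arrow L g m \<longleftrightarrow> \<not> g \<sqsubseteq>\<^bsub>L\<^esub> m \<and>
     (\<forall>h\<in>join_irreducibles L. object_intent L g \<subset> object_intent L h \<longrightarrow> h \<sqsubseteq>\<^bsub>L\<^esub> m)"

definition up_arrow :: "('a, 'b) gorder_scheme \<Rightarrow> 'a \<Rightarrow> 'a \<Rightarrow> bool" where
  "up_arrow L g m \<longleftrightarrow> \<not> g \<sqsubseteq>\<^bsub>L\<^esub> m \<and>
     (\<forall>y\<in>meet_irreducibles L. attribute_extent L m \<subset> attribute_extent L y \<longrightarrow> g \<sqsubseteq>\<^bsub>L\<^esub> y)"

text \<open>The types are stated together with their parameters, so that inequalities between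
  parameters can be added to them.\<close>

definition type_D :: "nat \<Rightarrow> nat \<Rightarrow> nat \<Rightarrow> nat \<Rightarrow> nat \<Rightarrow> nat list \<Rightarrow> bool" where
  "type_D n b k l d x \<longleftrightarrow>
     x \<in> partitions n \<and>
     x = pad n (replicate b (k + 1) @ replicate l k @ replicate d 1) \<and>
     l > 0 \<and> d > 0 \<and> k \<ge> 3 \<and> b + l \<ge> 2"

definition type_IV :: "nat \<Rightarrow> nat \<Rightarrow> nat \<Rightarrow> nat \<Rightarrow> nat \<Rightarrow> nat list \<Rightarrow> bool" where
  "type_IV n a t c r x \<longleftrightarrow>
     x \<in> partitions n \<and>
     x = pad n (a # replicate c t @ [r]) \<and>
     a > t \<and> t > r \<and> t \<ge> 2 \<and> c \<ge> 2"

end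

theory Submission
  imports Defs "HOL-Algebra.Complete_Lattice"
begin

text \<open>With \<open>p = b + l\<close>, a partition dominates \<open>g\<close> as soon as its \<open>p\<close>-th partial sum reaches that of \<open>g\<close>,
  because \<open>((k+1)\<^sup>b, k\<^sup>l)\<close> and \<open>(1\<^sup>d)\<close> are as balanced as possible. The \<open>p\<close>-th partial sum of \<open>m\<close> is
  exactly one smaller, while the earlier and later ones are not smaller than those of \<open>g\<close>; hence
  everything strictly below \<open>g\<close> is below \<open>m\<close>, which makes \<open>g\<close> join-irreducible and gives the down
  arrow. Dually, \<open>m\<close> has the unique upper cover \<open>(a, t+1, t, \<dots>, t, t-1, d+1)\<close>, so it is
  meet-irreducible; this cover has the same \<open>p\<close>-th partial sum as \<open>m\<close> and therefore still does
  not dominate \<open>g\<close>, which refutes the up arrow.\<close>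

section \<open>Irreducible elements and arrow relations in a complete lattice\<close>

text \<open>If \<open>x\<close> were the join of two elements other than \<open>x\<close>, both
  would lie below \<open>z\<close>, hence so would \<open>x\<close>. The bottom is excluded because
  it lies below \<open>z\<close>.\<close>

lemma (in complete_lattice) join_irreduciblesI:
  assumes "x \<in> carrier L" "z \<in> carrier L" "\<not> x \<sqsubseteq> z"
    and below: "\<And>y. y \<in> carrier L \<Longrightarrow> y \<sqsubseteq> x \<Longrightarrow> y \<noteq> x \<Longrightarrow> y \<sqsubseteq> z"
  shows "x \<in> join_irreducibles L"
  using assms unfolding join_irreducibles_def
  by (auto dest: bottom_lower) (metis join_le join_left join_right)

lemma (in complete_lattice) meet_irreduciblesI:
  assumes "x \<in> carrier L" "z \<in> carrier L" "\<not> z \<sqsubseteq> x"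
    and above: "\<And>y. y \<in> carrier L \<Longrightarrow> x \<sqsubseteq> y \<Longrightarrow> y \<noteq> x \<Longrightarrow> z \<sqsubseteq> y"
  shows "x \<in> meet_irreducibles L"
  using assms unfolding meet_irreducibles_def
  by (auto dest: top_higher) (metis meet_le meet_left meet_right)

text \<open>A minimal element among those below \<open>x\<close> but not below \<open>z\<close> is
  join-irreducible, since everything strictly below it is below \<open>z\<close>.\<close>

lemma (in complete_lattice) join_irreducible_separates:
  assumes fin: "finite (carrier L)" and "x \<in> carrier L" "z \<in> carrier L" "\<not> x \<sqsubseteq> z"
  obtains p where "p \<in> join_irreducibles L" "p \<sqsubseteq> x" "\<not> p \<sqsubseteq> z"
proof -
  \<comment> \<open>By finiteness this count grows strictly along the order, so a minimiser on
    \<open>P\<close> is a minimal element.\<close>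
  define size_below where "size_below p = card {y \<in> carrier L. y \<sqsubseteq> p}" for p
  define P where "P p \<longleftrightarrow> p \<in> carrier L \<and> p \<sqsubseteq> x \<and> \<not> p \<sqsubseteq> z" for p
  have "P x" using assms by (simp add: P_def)
  then obtain p where p: "P p" and least: "\<And>q. P q \<Longrightarrow> size_below p \<le> size_below q"
    using ex_has_least_nat[of P x size_below] by blast
  have "y \<sqsubseteq> z" if y: "y \<in> carrier L" "y \<sqsubseteq> p" "y \<noteq> p" for y
  proof (rule ccontr)
    assume "\<not> y \<sqsubseteq> z"
    with p y assms(2) have "P y" unfolding P_def by (meson le_trans)
    moreover have "{u \<in> carrier L. u \<sqsubseteq> y} \<subset> {u \<in> carrier L. u \<sqsubseteq> p}"
      using y p unfolding P_def by (auto intro: le_trans)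
    then have "size_below y < size_below p"
      unfolding size_below_def using fin by (simp add: psubset_card_mono)
    ultimately show False using least by fastforce
  qed
  then have "p \<in> join_irreducibles L"
    using p assms(3) by (intro join_irreduciblesI[of p z]) (auto simp: P_def)
  with p that show thesis by (auto simp: P_def)
qed

text \<open>Dually, a maximal element among those above \<open>x\<close> but not above
  \<open>z\<close> is chosen.\<close>

lemma (in complete_lattice) meet_irreducible_separates:
  assumes fin: "finite (carrier L)" and "x \<in> carrier L" "z \<in> carrier L" "\<not> z \<sqsubseteq> x"
  obtains p where "p \<in> meet_irreducibles L" "x \<sqsubseteq> p" "\<not> z \<sqsubseteq> p"
proof -
  define size_above where "size_above p = card {y \<in> carrier L. p \<sqsubseteq> y}" for p
  define P where "P p \<longleftrightarrow> p \<in> carrier L \<and> x \<sqsubseteq> p \<and> \<not> z \<sqsubseteq> p" for p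
  have "P x" using assms by (simp add: P_def)
  then obtain p where p: "P p" and least: "\<And>q. P q \<Longrightarrow> size_above p \<le> size_above q"
    using ex_has_least_nat[of P x size_above] by blast
  have "z \<sqsubseteq> y" if y: "y \<in> carrier L" "p \<sqsubseteq> y" "y \<noteq> p" for y
  proof (rule ccontr)
    assume "\<not> z \<sqsubseteq> y"
    with p y assms(2) have "P y" unfolding P_def by (meson le_trans)
    moreover have "{u \<in> carrier L. y \<sqsubseteq> u} \<subset> {u \<in> carrier L. p \<sqsubseteq> u}"
      using y p unfolding P_def by (auto intro: le_trans)
    then have "size_above y < size_above p"
      unfolding size_above_def using fin by (simp add: psubset_card_mono)
    ultimately show False using least by fastforce
  qed
  then have "p \<in> meet_irreducibles L"
    using p assms(3) by (intro meet_irreduciblesI[of p z]) (auto simp: P_def)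
  with p that show thesis by (auto simp: P_def)
qed

text \<open>Only elements \<open>h\<close> strictly below \<open>g\<close> matter: if
  \<open>h\<close> were not below \<open>g\<close>, a meet-irreducible above \<open>g\<close> but
  not above \<open>h\<close> would contradict the inclusion of intents.\<close>

lemma (in complete_lattice) down_arrowI:
  assumes fin: "finite (carrier L)" and g: "g \<in> carrier L" and "\<not> g \<sqsubseteq> m"
    and below: "\<And>y. y \<in> carrier L \<Longrightarrow> y \<sqsubseteq> g \<Longrightarrow> y \<noteq> g \<Longrightarrow> y \<sqsubseteq> m"
  shows "down_arrow L g m"
  unfolding down_arrow_def
proof (intro conjI ballI impI)
  fix h assume h: "h \<in> join_irreducibles L" and sub: "object_intent L g \<subset> object_intent L h"
  have hL: "h \<in> carrier L" using h by (simp add: join_irreducibles_def)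
  have "h \<sqsubseteq> g"
  proof (rule ccontr)
    assume "\<not> h \<sqsubseteq> g"
    then obtain p where "p \<in> meet_irreducibles L" "g \<sqsubseteq> p" "\<not> h \<sqsubseteq> p"
      using meet_irreducible_separates[OF fin g hL] by blast
    with sub show False by (auto simp: object_intent_def)
  qed
  with below hL sub show "h \<sqsubseteq> m" by blast
qed fact

text \<open>Some meet-irreducible \<open>y\<close> above \<open>q\<close> is still not above
  \<open>g\<close>; a join-irreducible below \<open>q\<close> but not below \<open>m\<close> makes
  the inclusion of extents strict.\<close>

lemma (in complete_lattice) not_up_arrowI:
  assumes fin: "finite (carrier L)" and carrier: "g \<in> carrier L" "m \<in> carrier L" "q \<in> carrier L"
    and "m \<sqsubseteq> q" "m \<noteq> q" "\<not> g \<sqsubseteq> q"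
  shows "\<not> up_arrow L g m"
proof -
  obtain y where y: "y \<in> meet_irreducibles L" "q \<sqsubseteq> y" "\<not> g \<sqsubseteq> y"
    using meet_irreducible_separates[OF fin] assms by blast
  have yL: "y \<in> carrier L" using y by (simp add: meet_irreducibles_def)
  have "\<not> q \<sqsubseteq> m" using assms by blast
  then obtain p where p: "p \<in> join_irreducibles L" "p \<sqsubseteq> q" "\<not> p \<sqsubseteq> m"
    using join_irreducible_separates[OF fin] carrier by blast
  have pL: "p \<in> carrier L" using p by (simp add: join_irreducibles_def)
  have "p \<sqsubseteq> y" using p y pL yL carrier by (meson le_trans)
  moreover have "m \<sqsubseteq> y" using assms y yL by (meson le_trans)
  ultimately have "attribute_extent L m \<subset> attribute_extent L y"
    using p yL carrier unfolding attribute_extent_def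
    by (auto simp: join_irreducibles_def intro: le_trans)
  with y show ?thesis unfolding up_arrow_def by blast
qed

section \<open>Partial sums of partitions\<close>

definition psum :: "nat list \<Rightarrow> nat \<Rightarrow> nat" where
  "psum a j = sum_list (take j a)"

lemma psum_0 [simp]: "psum a 0 = 0"
  by (simp add: psum_def)

lemma psum_Suc: "a \<in> partitions n \<Longrightarrow> j < n \<Longrightarrow> psum a (Suc j) = psum a j + a ! j"
  by (simp add: psum_def partitions_def take_Suc_conv_app_nth)

lemma psum_eq_total: "a \<in> partitions n \<Longrightarrow> n \<le> j \<Longrightarrow> psum a j = n"
  by (simp add: psum_def partitions_def)

lemma psum_mono: "i \<le> j \<Longrightarrow> psum a i \<le> psum a j"
  unfolding psum_def by (metis le_add1 le_add_diff_inverse sum_list_append take_add)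

lemma psum_le_total: "a \<in> partitions n \<Longrightarrow> psum a j \<le> n"
  using psum_mono[of j "max j n" a] psum_eq_total[of a n "max j n"] by simp

lemma partition_nth_antimono: "a \<in> partitions n \<Longrightarrow> i \<le> j \<Longrightarrow> j < n \<Longrightarrow> a ! j \<le> a ! i"
  by (cases "i = j") (auto simp: partitions_def sorted_wrt_iff_nth_less)

text \<open>The increments of \<open>psum a\<close> are the weakly decreasing entries; beyond the
  last entry the function is constantly \<open>n\<close>.\<close>

lemma psum_concave:
  assumes a: "a \<in> partitions n"
  shows "psum a j + psum a (Suc (Suc j)) \<le> 2 * psum a (Suc j)"
proof (cases "Suc j < n")
  case True
  then show ?thesis
    using psum_Suc[OF a, of j] psum_Suc[OF a, of "Suc j"] partition_nth_antimono[OF a, of j "Suc j"]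
    by simp
next
  case False
  then show ?thesis
    using psum_eq_total[OF a, of "Suc j"] psum_eq_total[OF a, of "Suc (Suc j)"]
      psum_le_total[OF a, of j]
    by simp
qed

lemma psum_upper:
  assumes a: "a \<in> partitions n" and "i \<le> j" "j \<le> n" "i < n"
  shows "psum a j \<le> psum a i + (j - i) * a ! i"
  using assms(2,3)
proof (induction j rule: dec_induct)
  case (step j)
  then show ?case
    using psum_Suc[OF a, of j] partition_nth_antimono[OF a, of i j] by (simp add: Suc_diff_le)
qed simp

lemma psum_lower:
  assumes a: "a \<in> partitions n" and "i \<le> j" "j \<le> n" "k < n" "j \<le> Suc k"
  shows "psum a i + (j - i) * a ! k \<le> psum a j"
  using assms(2,3,5)
proof (induction j rule: dec_induct)
  case (step j)
  then show ?case
    using psum_Suc[OF a, of j] partition_nth_antimono[OF a, of j k] assms(4)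
    by (simp add: Suc_diff_le)
qed simp

lemma partition_eqI:
  assumes "a \<in> partitions n" "b \<in> partitions n" "\<And>j. psum a j = psum b j"
  shows "a = b"
proof (rule nth_equalityI)
  show "length a = length b" using assms by (simp add: partitions_def)
  fix i assume "i < length a"
  then have "i < n" using assms by (simp add: partitions_def)
  then show "a ! i = b ! i"
    using psum_Suc[OF assms(1), of i] psum_Suc[OF assms(2), of i] assms(3) by simp
qed

section \<open>The dominance order as a complete lattice\<close>

lemma carrier_partition_lattice [simp]: "carrier (partition_lattice n) = partitions n"
  by (simp add: partition_lattice_def)

lemma le_partition_lattice:
  assumes "a \<in> partitions n" "b \<in> partitions n"
  shows "a \<sqsubseteq>\<^bsub>partition_lattice n\<^esub> b \<longleftrightarrow> (\<forall>j. psum a j \<le> psum b j)"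
proof -
  have "psum a j \<le> psum b j" if "\<forall>j\<in>{1..n}. psum a j \<le> psum b j" for j
    using that psum_eq_total[OF assms(1), of j] psum_eq_total[OF assms(2), of j]
    by (cases "j = 0"; cases "j \<le> n") auto
  then show ?thesis by (auto simp: partition_lattice_def psum_def)
qed

lemma finite_partitions: "finite (partitions n)"
proof (rule finite_subset)
  show "partitions n \<subseteq> {xs. set xs \<subseteq> {..n} \<and> length xs = n}"
    by (auto simp: partitions_def dest: member_le_sum_list)
  show "finite {xs. set xs \<subseteq> {..n} \<and> length xs = n}"
    by (rule finite_lists_length_eq) simp
qed

text \<open>Converse of \<open>psum_concave\<close>: the increments of \<open>F\<close> serve as
  entries. Monotonicity makes the natural subtraction exact, concavity sorts the entries.\<close>

lemma partition_of_concave: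
  fixes F :: "nat \<Rightarrow> nat"
  assumes "F 0 = 0" "F n = n" and mono: "\<And>j. F j \<le> F (Suc j)"
    and concave: "\<And>j. F j + F (Suc (Suc j)) \<le> 2 * F (Suc j)"
  obtains a where "a \<in> partitions n" "\<And>j. j \<le> n \<Longrightarrow> psum a j = F j"
proof -
  define D where "D i = F (Suc i) - F i" for i
  define a where "a = map D [0..<n]"
  have D: "F (Suc i) = F i + D i" for i using mono[of i] by (simp add: D_def)
  have sum: "sum_list (take j a) = F j" if "j \<le> n" for j
    using that
  proof (induction j)
    case (Suc j)
    then show ?case using D[of j] by (simp add: a_def take_Suc_conv_app_nth)
  qed (simp add: assms)
  have "D (Suc i) \<le> D i" for i using concave[of i] D[of i] D[of "Suc i"] by linarith
  then have "D j \<le> D i" if "i \<le> j" for i j using that by (rule lift_Suc_antimono_le)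
  then have "sorted_wrt (\<ge>) a" by (simp add: a_def sorted_wrt_iff_nth_less)
  moreover have "length a = n" by (simp add: a_def)
  ultimately have "a \<in> partitions n" using sum[of n] assms(2) by (simp add: partitions_def)
  with sum that show thesis by (simp add: psum_def)
qed

text \<open>A pointwise infimum of concave functions is concave.\<close>

lemma partition_Inf:
  assumes "A \<subseteq> partitions n" "A \<noteq> {}"
  obtains i where "i \<in> partitions n" "\<And>j. psum i j = (INF a\<in>A. psum a j)"
proof -
  define F where "F j = (INF a\<in>A. psum a j)" for j
  have le: "F j \<le> psum a j" if "a \<in> A" for a j
    unfolding F_def using that by (intro cINF_lower) auto
  \<comment> \<open>An infimum of natural numbers is attained, though the minimiser may depend on
    \<open>j\<close>.\<close>
  have att: "\<exists>a\<in>A. F j = psum a j" for j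
    using Inf_nat_def1[of "(\<lambda>a. psum a j) ` A"] assms(2) by (auto simp: F_def)
  have total: "F j = n" if "n \<le> j" for j
    using att[of j] psum_eq_total[OF _ that] assms(1) by auto
  have "F j \<le> F (Suc j)" for j
    using att[of "Suc j"] le[of _ j] psum_mono[of j "Suc j"] by (metis le_SucI le_trans order_refl)
  moreover have "F j + F (Suc (Suc j)) \<le> 2 * F (Suc j)" for j
  proof -
    \<comment> \<open>A minimiser at the middle index suffices, as its sums bound \<open>F\<close>
      from above at both neighbours.\<close>
    obtain a where "a \<in> A" "F (Suc j) = psum a (Suc j)" using att by blast
    then show ?thesis
      using le[of a j] le[of a "Suc (Suc j)"] psum_concave[of a n j] assms(1) by fastforce
  qed
  moreover have "F 0 = 0" using att[of 0] by auto
  ultimately obtain i where i: "i \<in> partitions n" "\<And>j. j \<le> n \<Longrightarrow> psum i j = F j"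
    using partition_of_concave[of F n] total[of n] by blast
  then have "psum i j = F j" for j
    using total[of j] psum_eq_total[OF i(1), of j] by (cases "j \<le> n") auto
  with i that show thesis by (simp add: F_def)
qed

text \<open>A greatest element and infima of nonempty sets suffice; suprema are infima of sets of
  upper bounds.\<close>

lemma partition_lattice_complete: "complete_lattice (partition_lattice n)"
proof (rule partial_order.complete_lattice_criterion1)
  show "partial_order (partition_lattice n)"
  proof
    fix x y assume *: "x \<sqsubseteq>\<^bsub>partition_lattice n\<^esub> y" "y \<sqsubseteq>\<^bsub>partition_lattice n\<^esub> x"
      "x \<in> carrier (partition_lattice n)" "y \<in> carrier (partition_lattice n)"
    then have "x = y" by (auto simp: le_partition_lattice intro!: partition_eqI le_antisym)
    then show "x .=\<^bsub>partition_lattice n\<^esub> y" by (simp add: partition_lattice_def)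
  qed (auto simp: partition_lattice_def intro: order_trans)
next
  define top where "top = (if n = 0 then [] else n # replicate (n - 1) 0)"
  have top: "top \<in> partitions n" by (auto simp: top_def partitions_def sum_list_replicate
      sorted_wrt_iff_nth_less nth_Cons split: nat.splits)
  have "psum x j \<le> psum top j" if "x \<in> partitions n" for x j
    using psum_le_total[OF that, of j] by (cases j) (auto simp: top_def psum_def)
  then have "greatest (partition_lattice n) top (carrier (partition_lattice n))"
    using top by (auto simp: greatest_def le_partition_lattice)
  then show "\<exists>g. greatest (partition_lattice n) g (carrier (partition_lattice n))" ..
next
  fix A assume A: "A \<subseteq> carrier (partition_lattice n)" "A \<noteq> {}"
  then obtain i where i: "i \<in> partitions n" "\<And>j. psum i j = (INF a\<in>A. psum a j)"
    using partition_Inf[of A n] by auto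
  have "greatest (partition_lattice n) i (Lower (partition_lattice n) A)"
  proof (rule greatest_LowerI)
    show "i \<sqsubseteq>\<^bsub>partition_lattice n\<^esub> x" if "x \<in> A" for x
      using that A i by (auto simp: le_partition_lattice subset_iff intro: cINF_lower)
    fix y assume y: "y \<in> Lower (partition_lattice n) A"
    then have yn: "y \<in> partitions n" by (simp add: Lower_def)
    have "psum y j \<le> psum x j" if "x \<in> A" for x j
      using y that A yn by (force simp: Lower_def le_partition_lattice)
    then show "y \<sqsubseteq>\<^bsub>partition_lattice n\<^esub> i"
      using A(2) yn i by (auto simp: le_partition_lattice intro: cINF_greatest)
  qed (use A i in auto)
  then show "\<exists>i. greatest (partition_lattice n) i (Lower (partition_lattice n) A)" ..
qed

section \<open>Partitions of types D and IV\<close>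

lemma sorted_wrt_ge_replicate [simp]: "sorted_wrt (\<ge>) (replicate c (x::nat))"
  by (simp add: sorted_wrt_iff_nth_less)

text \<open>Dominance over a type D partition is decided by one partial sum.\<close>

lemma type_D_le_iff:
  assumes "l > 0" "d > 0" and h: "h \<in> partitions n"
    and n: "n = b * (k + 1) + l * k + d"
    and g: "g \<in> partitions n" "g = pad n (replicate b (k + 1) @ replicate l k @ replicate d 1)"
  shows "(\<forall>j. psum g j \<le> psum h j) \<longleftrightarrow> (b + l) * k + b \<le> psum h (b + l)"
    and "j \<le> b + l \<Longrightarrow> psum g j = j * k + min j b"
proof -
  have "length g = n" using g(1) by (simp add: partitions_def)
  then have bln: "b + l < n" using \<open>d > 0\<close> g(2) by (simp add: pad_def)
  have psum_g: "psum g j = min j b * (k + 1) + min (j - b) l * k + min (j - (b + l)) d" for j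
    by (simp add: g(2) psum_def pad_def sum_list_replicate)
  have low: "psum g j = j * k + min j b" if "j \<le> b + l" for j
  proof (cases "j \<le> b")
    case False
    then obtain i where "j = b + i" by (metis le_add_diff_inverse nat_le_linear)
    then show ?thesis using that by (simp add: psum_g algebra_simps)
  qed (simp add: psum_g)
  then show "j \<le> b + l \<Longrightarrow> psum g j = j * k + min j b" by simp
  have "psum g j \<le> psum h j" if H: "(b + l) * k + b \<le> psum h (b + l)" for j
  proof (cases "j \<le> b + l")
    case True
    \<comment> \<open>If \<open>h\<close> fell short at \<open>j\<close>, its entries from
      \<open>j\<close> up to \<open>b + l\<close> would have to average more than \<open>k\<close>.
      Then \<open>h ! j\<close> and all earlier entries are at least \<open>k + 1\<close>, so
      \<open>h\<close> cannot fall short at \<open>j\<close>.\<close>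
    show ?thesis
    proof (rule ccontr)
      assume "\<not> ?thesis"
      then have less: "psum h j < j * k + min j b" using low True by simp
      then have "j < b + l" using H True by (cases "j = b + l") auto
      then have "psum h (b + l) \<le> psum h j + (b + l - j) * h ! j"
        using psum_upper[OF h, of j "b + l"] bln by simp
      moreover have "(b + l) * k = j * k + (b + l - j) * k"
        using True by (metis add_mult_distrib le_add_diff_inverse)
      ultimately have "(b + l - j) * k < (b + l - j) * h ! j" using less H by linarith
      then have "k + 1 \<le> h ! j" by simp
      then have "j * (k + 1) \<le> j * h ! j" by (rule mult_le_mono2)
      then show False
        using psum_lower[OF h, of 0 j j] \<open>j < b + l\<close> bln less by simp
    qed
  next
    case False
    \<comment> \<open>Beyond \<open>b + l\<close>, \<open>g\<close> gains at most 1 per entry.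
      Either \<open>h\<close> gains at least 1 per entry up to \<open>j\<close>, or it has already
      reached its total \<open>n\<close>.\<close>
    show ?thesis
    proof (cases "j < n \<and> h ! j > 0")
      case True
      then have "psum h (b + l) + (j - (b + l)) * 1 \<le> psum h (b + l) + (j - (b + l)) * h ! j"
        by (intro add_left_mono mult_le_mono2) simp
      also have "\<dots> \<le> psum h j" using psum_lower[OF h, of "b + l" j j] False True by simp
      finally show ?thesis using False H by (simp add: psum_g algebra_simps)
    next
      case zero: False
      have "n \<le> psum h j"
      proof (cases "j < n")
        case True
        then show ?thesis using psum_upper[OF h, of j n] psum_eq_total[OF h, of n] zero by simp
      next
        case False
        then show ?thesis using psum_eq_total[OF h, of j] by simp
      qed
      then show ?thesis using psum_le_total[OF g(1), of j] by linarith
    qed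
  qed
  moreover have "psum g (b + l) = (b + l) * k + b" using low[of "b + l"] by simp
  ultimately show "(\<forall>j. psum g j \<le> psum h j) \<longleftrightarrow> (b + l) * k + b \<le> psum h (b + l)"
    by metis
qed

text \<open>A concave function that lies above one that is affine on \<open>{1..c + 1}\<close> and touches it at an
  interior point of that interval agrees with it there.\<close>

lemma type_IV_touch:
  assumes h: "h \<in> partitions n" and m: "m \<in> partitions n"
    and psum_m: "\<And>j. 1 \<le> j \<Longrightarrow> j \<le> c + 1 \<Longrightarrow> psum m j = a + (j - 1) * t"
      "\<And>j. c + 2 \<le> j \<Longrightarrow> psum m j = n"
    and cn: "c + 1 < n"
    and ge: "\<And>j. psum m j \<le> psum h j"
    and i: "2 \<le> i" "i \<le> c" "psum h i = psum m i"
  shows "h = m"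
proof -
  \<comment> \<open>Comparison with \<open>m\<close> at \<open>i - 1\<close> and
    \<open>i + 1\<close>, both still in the affine range, gives
    \<open>h ! (i - 1) \<le> t \<le> h ! i\<close>. As entries decrease, both equal
    \<open>t\<close>.\<close>
  have "psum h (i - 1) \<ge> a + (i - 2) * t"
    using ge[of "i - 1"] i psum_m(1)[of "i - 1"] by (simp add: numeral_2_eq_2)
  moreover have hi: "psum h i = a + (i - 1) * t" using i psum_m(1)[of i] by simp
  moreover have "psum h i = psum h (i - 1) + h ! (i - 1)"
    using psum_Suc[OF h, of "i - 1"] i cn by simp
  moreover have "(i - 1) * t = (i - 2) * t + t"
    using i by (cases i; cases "i - 1") auto
  ultimately have upper: "h ! (i - 1) \<le> t" by linarith
  have "psum h (Suc i) \<ge> a + i * t" using ge[of "Suc i"] i psum_m(1)[of "Suc i"] by simp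
  moreover have "psum h (Suc i) = psum h i + h ! i" using psum_Suc[OF h, of i] i cn by simp
  moreover have "i * t = (i - 1) * t + t" using i by (cases i) auto
  ultimately have lower: "t \<le> h ! i" using hi by linarith
  have anti: "h ! i \<le> h ! (i - 1)" using partition_nth_antimono[OF h, of "i - 1" i] i cn by simp
  have "psum h j \<le> psum m j" for j
  proof -
    consider "j = 0" | "1 \<le> j" "j \<le> i" | "i \<le> j" "j \<le> c + 1" | "c + 2 \<le> j" by linarith
    then show ?thesis
    proof cases
      \<comment> \<open>Extrapolating from \<open>i\<close> with slope \<open>t\<close>, to the left
        here and to the right in the next case, bounds \<open>h\<close> by \<open>m\<close>.\<close>
      case 2
      then have "psum h j + (i - j) * h ! (i - 1) \<le> psum h i"
        using psum_lower[OF h, of j i "i - 1"] i cn by simp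
      moreover have "(i - j) * t \<le> (i - j) * h ! (i - 1)"
        using lower anti by (intro mult_le_mono2) simp
      moreover have "(i - 1) * t = (j - 1) * t + (i - j) * t"
        using 2 by (simp flip: add_mult_distrib)
      ultimately show ?thesis using hi psum_m(1)[of j] 2 i by linarith
    next
      case 3
      then have "psum h j \<le> psum h i + (j - i) * h ! i" using psum_upper[OF h, of i j] i cn by simp
      moreover have "(j - i) * h ! i \<le> (j - i) * t" using upper anti by (intro mult_le_mono2) simp
      moreover have "(j - 1) * t = (i - 1) * t + (j - i) * t"
        using 3 i by (simp flip: add_mult_distrib)
      ultimately show ?thesis using hi psum_m(1)[of j] 3 i by linarith
    qed (use psum_m(2) psum_le_total[OF h] in auto)
  qed
  with ge show ?thesis by (intro partition_eqI[OF h m] le_antisym)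
qed

section \<open>The pair \<open>g\<close>, \<open>m\<close> and the upper cover of
  \<open>m\<close>\<close>

theorem theorem5p6:
  fixes b k l d t n a :: nat and g m :: "nat list"
  assumes "k > 0" and "l > 0" and "d > 0" and "t > 0"
    and "b + l \<ge> 3" and "d + 1 < t" and "t \<le> k - 1"
    and "n = b * (k + 1) + l * k + d"
    and "a = b + (b + l) * (k - t) + t - 1"
    and "g = pad n (replicate b (k + 1) @ replicate l k @ replicate d 1)"
    and "m = pad n (a # replicate (b + l - 1) t @ [d + 1])"
  shows "g \<in> join_irreducibles (partition_lattice n) \<and> type_D n b k l d g \<and> k \<ge> 4 \<and>
    m \<in> meet_irreducibles (partition_lattice n) \<and> type_IV n a t (b + l - 1) (d + 1) m \<and> a \<ge> t + 2 \<and>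
    down_arrow (partition_lattice n) g m \<and> \<not> up_arrow (partition_lattice n) g m"
proof -
  define p c r where "p = b + l" and "c = p - 1" and "r = d + 1"
  have pc: "p = c + 1" "c \<ge> 2" and r: "2 \<le> r" "r < t"
    using assms by (auto simp: p_def c_def r_def)
  \<comment> \<open>Writing \<open>k - t\<close> as \<open>s\<close> removes the natural subtraction
    from \<open>a\<close>.\<close>
  obtain s where k: "k = t + s" "s \<ge> 1"
    using less_imp_add_positive[of t k] assms(1,4,7) by force
  have a: "a = b + p * s + t - 1" using assms(9) k by (simp add: p_def)
  have ps: "p * s \<ge> 3" using mult_le_mono[OF assms(5) k(2)] by (simp add: p_def)
  have at: "a \<ge> t + 2" using ps a by linarith
  have k4: "k \<ge> 4" using assms by linarith
  have np: "n = p * k + b + d" using assms(8) by (simp add: p_def algebra_simps)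
  have nm: "n = a + c * t + r"
    using np a k r assms(6) by (simp add: pc r_def algebra_simps)
  have "p * 4 \<le> p * k" using k4 by (rule mult_le_mono2)
  then have pn: "p + d < n" "c + 2 \<le> n" using np pc by linarith+
  have g: "g \<in> partitions n"
    unfolding partitions_def using pn assms(8) k4
    by (auto simp: assms(10) pad_def sorted_wrt_append sum_list_replicate p_def)
  have m_eq: "m = pad n (a # replicate c t @ [r])"
    using assms(11) by (simp add: p_def c_def r_def)
  have m: "m \<in> partitions n"
    unfolding partitions_def using pn nm at r
    by (auto simp: m_eq pad_def sorted_wrt_append sum_list_replicate)
  \<comment> \<open>The upper cover of \<open>m\<close>: one unit moves from entry
    \<open>p = c + 1\<close> to entry 2, which raises exactly the sums at \<open>2, ..., c\<close>.
    It stays sorted because \<open>r < t\<close> and \<open>a \<ge> t + 2\<close>.\<close>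
  define q where "q = pad n (a # (t + 1) # replicate (c - 2) t @ [t - 1, r])"
  have q: "q \<in> partitions n"
  proof -
    obtain c' where "c = c' + 2" using pc by (metis add.commute le_add_diff_inverse)
    then show ?thesis
      unfolding partitions_def using pn nm at r
      by (auto simp: q_def pad_def sorted_wrt_append sum_list_replicate)
  qed
  have psum_m: "psum m j = a + (j - 1) * t" if "1 \<le> j" "j \<le> c + 1" for j
    using that unfolding m_eq
    by (cases j) (auto simp: pad_def psum_def sum_list_replicate)
  have psum_m': "psum m j = n" if "c + 2 \<le> j" for j
    using that nm unfolding m_eq
    by (auto simp: pad_def psum_def sum_list_replicate take_Cons')
  have psum_q: "psum q j = psum m j + (if 2 \<le> j \<and> j \<le> c then 1 else 0)" for j
  proof -
    obtain c' where c': "c = c' + 2" using pc by (metis add.commute le_add_diff_inverse)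
    consider "j = 0" | "j = 1" | "2 \<le> j" "j \<le> c" | "j = c + 1" | "c + 2 \<le> j" by linarith
    then show ?thesis
    proof cases
      case 3
      then obtain i where "j = i + 2" "i \<le> c'"
        using c' by (metis add.commute add_le_cancel_right le_add_diff_inverse)
      then show ?thesis using psum_m[of j] c'
        by (simp add: q_def psum_def pad_def sum_list_replicate)
    next
      case 4
      then show ?thesis using psum_m[of j] c' at r
        by (simp add: q_def psum_def pad_def sum_list_replicate)
    next
      case 5
      then show ?thesis using psum_m'[of j] c' at r nm
        by (simp add: q_def psum_def pad_def sum_list_replicate take_Cons')
    qed (use psum_m[of j] in \<open>auto simp: q_def psum_def pad_def\<close>)
  qed
  let ?L = "partition_lattice n"
  interpret complete_lattice ?L by (rule partition_lattice_complete)
  have fin: "finite (carrier ?L)" by (simp add: finite_partitions)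
  have g_le: "g \<sqsubseteq>\<^bsub>?L\<^esub> h \<longleftrightarrow> p * k + b \<le> psum h p" if "h \<in> partitions n" for h
    using type_D_le_iff(1)[OF assms(2,3) that assms(8) g assms(10)] that g
    by (simp add: le_partition_lattice p_def)
  have psum_g: "psum g j = j * k + min j b" if "j \<le> p" for j
    using type_D_le_iff(2)[OF assms(2,3) g assms(8) g assms(10)] that by (simp add: p_def)
  have psum_mp: "psum m p + 1 = p * k + b"
    using psum_m[of p] a k r by (simp add: pc algebra_simps)
  have not_le: "\<not> g \<sqsubseteq>\<^bsub>?L\<^esub> m" using g_le[OF m] psum_mp by simp
  \<comment> \<open>The index \<open>p = c + 1\<close> lies just outside the range where
    \<open>q\<close> exceeds \<open>m\<close>.\<close>
  have not_le_q: "\<not> g \<sqsubseteq>\<^bsub>?L\<^esub> q" using g_le[OF q] psum_mp psum_q[of p] pc by simp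
  have below: "y \<sqsubseteq>\<^bsub>?L\<^esub> m" if y: "y \<in> carrier ?L" "y \<sqsubseteq>\<^bsub>?L\<^esub> g" "y \<noteq> g" for y
  proof -
    have yn: "y \<in> partitions n" using y by simp
    have "\<not> g \<sqsubseteq>\<^bsub>?L\<^esub> y" using y g le_antisym by auto
    then have yp: "psum y p \<le> psum m p" using g_le[OF yn] psum_mp by simp
    have yg: "psum y j \<le> psum g j" for j using y yn g by (simp add: le_partition_lattice)
    have "psum y j \<le> psum m j" for j
    proof -
      consider "j = 0" | "1 \<le> j" "j < p" | "j = p" | "p < j" by linarith
      then show ?thesis
      proof cases
        \<comment> \<open>The slack \<open>a + (j - 1) * t - (j * k + b)\<close> equals
          \<open>(p - j) * s - 1\<close>, which is nonnegative since \<open>j < p\<close> and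
          \<open>s \<ge> 1\<close>. Substituting \<open>u\<close> and \<open>i\<close> avoids
          natural subtraction.\<close>
        case 2
        then obtain u where u: "p = j + u + 1"
          using less_imp_Suc_add[of j p] by auto
        obtain i where i: "j = i + 1" using 2 by (metis add.commute le_add_diff_inverse)
        have "psum g j \<le> j * k + b" using psum_g[of j] 2 by simp
        also have "\<dots> \<le> a + (j - 1) * t"
          using k r by (simp add: a u i algebra_simps)
        finally show ?thesis using yg[of j] psum_m[of j] 2 pc by simp
      next
        case 4
        then show ?thesis using psum_m'[of j] psum_le_total[OF yn] pc by simp
      qed (use yp in auto)
    qed
    then show ?thesis using yn m by (simp add: le_partition_lattice)
  qed
  have above: "q \<sqsubseteq>\<^bsub>?L\<^esub> y" if y: "y \<in> carrier ?L" "m \<sqsubseteq>\<^bsub>?L\<^esub> y" "y \<noteq> m" for y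
  proof -
    have yn: "y \<in> partitions n" using y by simp
    have my: "psum m j \<le> psum y j" for j using y yn m by (simp add: le_partition_lattice)
    \<comment> \<open>Touching \<open>m\<close> at such an index would force \<open>y = m\<close>;
      so \<open>y\<close> exceeds \<open>m\<close> by at least 1 wherever \<open>q\<close>
      does.\<close>
    have "psum y j \<noteq> psum m j" if "2 \<le> j" "j \<le> c" for j
      using type_IV_touch[OF yn m psum_m psum_m' _ my that] y(3) pn by auto
    then have "psum q j \<le> psum y j" for j
      using my[of j] by (cases "2 \<le> j \<and> j \<le> c") (fastforce simp: psum_q order_le_less)+
    then show ?thesis using yn q by (simp add: le_partition_lattice)
  qed
  \<comment> \<open>Index 2 witnesses strictness; it is in range because
    \<open>c \<ge> 2\<close>.\<close>
  have mq: "m \<sqsubseteq>\<^bsub>?L\<^esub> q" "\<not> q \<sqsubseteq>\<^bsub>?L\<^esub> m"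
    using m q pc by (auto simp: le_partition_lattice psum_q intro!: exI[of _ 2])
  have "g \<in> join_irreducibles ?L"
    using join_irreduciblesI[of g m] g m not_le below by simp
  moreover have "m \<in> meet_irreducibles ?L"
    using meet_irreduciblesI[of m q] m q mq above by simp
  moreover have "down_arrow ?L g m"
    using down_arrowI[OF fin] g not_le below by simp
  moreover have "\<not> up_arrow ?L g m"
    using not_up_arrowI[OF fin, of g m q] g m q mq not_le_q by auto
  moreover have "type_D n b k l d g"
    using g assms k4 by (simp add: type_D_def)
  moreover have "type_IV n a t (b + l - 1) (d + 1) m"
    using m assms(11) at r pc by (simp add: type_IV_def p_def c_def r_def)
  ultimately show ?thesis using k4 at by simp
qed

end
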